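(* Let $A\in\mathbb{C}^{n\times n}$ be non-nilpotent with $\mathrm{ind}(A)=1$. Then $$A^{\text{core}}=\lim_{\lambda\to 0}A(A^{2})^{*}\bigl(A^{2}(A^{2})^{*}+\lambda I\bigr)^{-1}=\lim_{\lambda\to 0}A\bigl((A^{2})^{*}A^{2}+\lambda I\bigr)^{-1}(A^{2})^{*}$$ and $$A_{\text{core}}=\lim_{\lambda\to 0}\bigl((A^{2})^{*}A^{2}+\lambda I\bigr)^{-1}(A^{2})^{*}A=\lim_{\lambda\to 0}(A^{2})^{*}\bigl(A^{2}(A^{2})^{*}+\lambda I\bigr)^{-1}A,$$ where $A^{\text{core}}$ is the core inverse of $A$ and $A_{\text{core}}$ is the dual core inverse of $A$.
   Context: $M^*$ is the conjugate transpose, $\mathrm{rk}(M)$ the rank, $R(M)$ the range (column space) of a complex matrix $M$, $P_M$ is the orthogonal projector onto $R(M)$, and $I$ is the identity matrix. The index $\mathrm{ind}(A)$ is the smallest nonnegative integer $k$ with $\mathrm{rk}(A^k)=\mathrm{rk}(A^{k+1})$. For $A\in\mathbb{C}^{n\times n}$ of index at most 1, the core inverse $A^{\text{core}}$ is the unique $X\in\mathbb{C}^{n\times n}$ with $AX=P_A$ and $R(X)\subseteq R(A)$; the dual core inverse $A_{\text{core}}$ is the unique $X\in\mathbb{C}^{n\times n}$ with $XA=P_{A^*}$ and $R(X)\subseteq R(A^* )$. Limits are taken as $\lambda\to0$ through nonzero complex scalars; for all sufficiently small $\lambda\ne 0$ the indicated inverses exist.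
   Formalization: The dual core inverse is defined with the extra condition R(X* ) ⊆ R(A* ), since XA = P_{A*} and R(X) ⊆ R(A* ) alone do not determine X (for A = diag(1,0), both A and [[1,1],[0,0]] qualify). *)

theory Defs
  imports "HOL-Analysis.Analysis"
begin

definition cadjoint :: "complex^'n^'m \<Rightarrow> complex^'m^'n" where
  "cadjoint M = map_matrix cnj (transpose M)"

(* The library's ^ on vectors is componentwise, hence a separate matrix power. *)
definition matpow :: "complex^'n^'n \<Rightarrow> nat \<Rightarrow> complex^'n^'n" where
  "matpow A k = (((**) A) ^^ k) (mat 1)"

definition nilpotent_matrix :: "complex^'n^'n \<Rightarrow> bool" where
  "nilpotent_matrix A \<longleftrightarrow> (\<exists>k. matpow A k = 0)"

definition matrix_range :: "complex^'n^'m \<Rightarrow> (complex^'m) set" where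
  "matrix_range M = range (\<lambda>x. M *v x)"

definition matrix_index :: "complex^'n^'n \<Rightarrow> nat" where
  "matrix_index A = (LEAST k. rank (matpow A k) = rank (matpow A (k + 1)))"

(* The orthogonal projector onto a subspace is the Hermitian idempotent with that range. *)
definition is_range_projector :: "complex^'n^'m \<Rightarrow> complex^'m^'m \<Rightarrow> bool" where
  "is_range_projector M P \<longleftrightarrow>
     P ** P = P \<and> cadjoint P = P \<and> matrix_range P = matrix_range M"

definition range_projector :: "complex^'n^'m \<Rightarrow> complex^'m^'m" where
  "range_projector M = (THE P. is_range_projector M P)"

definition is_core_inverse :: "complex^'n^'n \<Rightarrow> complex^'n^'n \<Rightarrow> bool" where
  "is_core_inverse A X \<longleftrightarrow>
     A ** X = range_projector A \<and> matrix_range X \<subseteq> matrix_range A"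

(* Meaningful for matrices of index at most 1, where the core inverse exists and is unique. *)
definition core_inverse :: "complex^'n^'n \<Rightarrow> complex^'n^'n" where
  "core_inverse A = (THE X. is_core_inverse A X)"

(* The dual core inverse is often described by the first two conditions alone, but these do
   not determine X: for A = diag(1,0) both X = A and X = [[1,1],[0,0]] satisfy them.  The third
   condition (equivalently, the null space of A is contained in that of X) restores uniqueness.
   The three together say that cadjoint X is the core inverse of cadjoint A. *)
definition is_dual_core_inverse :: "complex^'n^'n \<Rightarrow> complex^'n^'n \<Rightarrow> bool" where
  "is_dual_core_inverse A X \<longleftrightarrow>
     X ** A = range_projector (cadjoint A) \<and>
     matrix_range X \<subseteq> matrix_range (cadjoint A) \<and>
     matrix_range (cadjoint X) \<subseteq> matrix_range (cadjoint A)"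

(* Meaningful for matrices of index at most 1, as for the core inverse. *)
definition dual_core_inverse :: "complex^'n^'n \<Rightarrow> complex^'n^'n" where
  "dual_core_inverse A = (THE X. is_dual_core_inverse A X)"

end

theory Submission
  imports Defs
begin

text \<open>
  Write B for the square of A, D for the conjugate transpose of B, and let K be the group inverse
  of the Hermitian matrix H = B D.  The resolvent of H splits as
  (H + \<mu>)^-1 = K (1 + \<mu> K)^-1 + (1 - H K) / \<mu>, and D (1 - H K) = 0, so D (H + \<mu>)^-1
  tends to D K, the Moore-Penrose inverse of B.  The push-through identity
  (D B + \<mu>)^-1 D = D (B D + \<mu>)^-1 gives the same limit for the other resolvent.  Index 1 yields
  factorizations A = V A A = A A W, so that A and B have the same range and likewise their adjoints;
  hence A D K and D K A satisfy the equations of the core and dual core inverse, and the same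
  factorizations show that these have only one solution.
\<close>

section \<open>Matrix arithmetic with scalar matrices and inverses\<close>

lemma matrix_add_rdistrib: "(A + B) ** C = A ** C + B ** (C :: 'a::semiring_1^'n^'m)"
  by (vector matrix_matrix_mult_def sum.distrib[symmetric] distrib_right)

lemma matrix_diff_ldistrib: "A ** (B - C) = A ** B - A ** (C :: 'a::ring_1^'n^'m)"
  by (vector matrix_matrix_mult_def sum_subtractf[symmetric] right_diff_distrib)

lemma mat_mult_component: "(mat c ** A) $ i $ j = c * A $ i $ j"
  by (simp add: matrix_matrix_mult_def mat_def if_distrib[of "\<lambda>x. x * y" for y] cong: if_cong)

lemma mult_mat_component: "(A ** mat c) $ i $ j = A $ i $ j * c"
  by (simp add: matrix_matrix_mult_def mat_def if_distrib[of "\<lambda>x. y * x" for y] cong: if_cong)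

lemma mat_mult_commute: "mat c ** A = A ** mat (c :: 'a::comm_semiring_1)"
  by (simp add: vec_eq_iff mat_mult_component mult_mat_component mult.commute)

lemma mat_mult_mat: "mat a ** mat b = mat (a * b)"
  by (simp add: vec_eq_iff mat_mult_component) (simp add: mat_def)

lemma matrix_inv:
  assumes "invertible A"
  shows "A ** matrix_inv A = mat 1" and "matrix_inv A ** A = mat 1"
  using someI_ex[OF assms[unfolded invertible_def]] unfolding matrix_inv_def by blast+

lemma matrix_inv_unique:
  fixes A :: "'a::field^'n^'n"
  assumes "A ** B = mat 1"
  shows "matrix_inv A = B"
  by (metis assms invertible_right_inverse matrix_inv matrix_mul_assoc matrix_mul_lid matrix_mul_rid)

section \<open>Conjugate transposes and cancellation\<close>

lemma cadjoint_cadjoint [simp]: "cadjoint (cadjoint M) = M"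
  by (simp add: cadjoint_def transpose_def vec_eq_iff)

lemma cadjoint_mult: "cadjoint (M ** N) = cadjoint N ** cadjoint M"
  by (simp add: cadjoint_def transpose_def vec_eq_iff matrix_matrix_mult_def mult.commute)

text \<open>The diagonal entries of the product are the squared Euclidean norms of the columns of
  \<open>M\<close>.\<close>

lemma cadjoint_mult_self_eq_0:
  assumes "cadjoint M ** M = 0"
  shows "M = 0"
proof -
  have "M $ i $ j = 0" for i j
  proof -
    have "(\<Sum>k\<in>UNIV. cnj (M $ k $ j) * M $ k $ j) = (cadjoint M ** M) $ j $ j"
      by (simp add: cadjoint_def transpose_def matrix_matrix_mult_def)
    also have "\<dots> = 0"
      using assms by simp
    finally have "of_real (\<Sum>k\<in>UNIV. (cmod (M $ k $ j))\<^sup>2) = (0 :: complex)"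
      by (simp add: complex_norm_square mult.commute del: of_real_power)
    then have "(\<Sum>k\<in>UNIV. (cmod (M $ k $ j))\<^sup>2) = 0"
      by (simp only: of_real_eq_0_iff)
    then show ?thesis
      by (simp add: sum_nonneg_eq_0_iff)
  qed
  then show ?thesis
    by (simp add: vec_eq_iff)
qed

text \<open>Multiplying the hypothesis by \<open>cadjoint N\<close> from the left gives the Gram
  matrix of \<open>M ** N\<close>, which therefore vanishes.\<close>

lemma cadjoint_mult_cancel:
  assumes "cadjoint M ** M ** N = 0"
  shows "M ** N = 0"
proof (rule cadjoint_mult_self_eq_0)
  have "cadjoint (M ** N) ** (M ** N) = cadjoint N ** (cadjoint M ** M ** N)"
    by (simp add: cadjoint_mult matrix_mul_assoc)
  then show "cadjoint (M ** N) ** (M ** N) = 0"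
    by (simp add: assms)
qed

section \<open>Ranges, ranks and factorizations\<close>

text \<open>The columns of \<open>Z\<close> are chosen preimages under \<open>N\<close> of the
  columns of \<open>M\<close>.\<close>

lemma range_subset_imp_factor:
  fixes M :: "'a::field^'n^'m" and N :: "'a^'k^'m"
  assumes "range ((*v) M) \<subseteq> range ((*v) N)"
  obtains Z where "M = N ** Z"
proof -
  have "\<forall>j. \<exists>z. M *v axis j 1 = N *v z"
    using assms by blast
  then obtain z where z: "\<And>j. M *v axis j 1 = N *v z j"
    by metis
  have "M = N ** (\<chi> i j. z j $ i)"
    using z by (simp add: vec_eq_iff matrix_vector_mul_component matrix_vector_mult_def
        matrix_matrix_mult_def axis_def if_distrib cong: if_cong)
  then show thesis
    by (rule that)
qed

lemma matrix_range_subset_iff: "matrix_range M \<subseteq> matrix_range N \<longleftrightarrow> (\<exists>Z. M = N ** Z)"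
proof
  assume "matrix_range M \<subseteq> matrix_range N"
  then show "\<exists>Z. M = N ** Z"
    unfolding matrix_range_def by (metis range_subset_imp_factor)
next
  assume "\<exists>Z. M = N ** Z"
  then show "matrix_range M \<subseteq> matrix_range N"
    by (auto simp: matrix_range_def simp flip: matrix_vector_mul_assoc)
qed

lemma subspace_range_matrix: "vec.subspace (range ((*v) (M :: 'a::field^'n^'m)))"
  by (intro vec.subspace_image vec.subspace_UNIV)

lemma span_columns_eq_range:
  fixes M :: "'a::field^'n^'m"
  shows "vec.span (columns M) = range ((*v) M)"
proof
  have "column j M = M *v axis j 1" for j
    by (simp add: vec_eq_iff column_def matrix_vector_mult_def axis_def if_distrib cong: if_cong)
  then have "columns M \<subseteq> range ((*v) M)"
    by (auto simp: columns_def)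
  then show "vec.span (columns M) \<subseteq> range ((*v) M)"
    using subspace_range_matrix by (rule vec.span_minimal)
qed (use matrix_vector_mult_in_columnspace_gen in blast)

text \<open>The library defines \<^const>\<open>rank\<close> as the row rank and equates it with the column rank only
  over the reals, so over a general field the range of the transpose has to be used.\<close>

lemma rank_eq_dim_range_transpose:
  fixes A :: "'a::field^'n^'m"
  shows "rank A = vec.dim (range ((*v) (transpose A)))"
  unfolding row_rank_def_gen
  by (simp del: transpose_matrix_vector flip: span_columns_eq_range)

lemma rank_mult_le_right:
  fixes A :: "'a::field^'n^'m" and B :: "'a^'k^'n"
  shows "rank (A ** B) \<le> rank B"
  unfolding rank_eq_dim_range_transpose
  by (rule vec.dim_subset)
     (auto simp: matrix_transpose_mul simp del: transpose_matrix_vector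
        simp flip: matrix_vector_mul_assoc)

text \<open>The row space of \<open>A ** B\<close> lies in that of \<open>B\<close>, and equal
  dimensions make the two coincide. The rows of \<open>B\<close> are then combinations of those of
  \<open>A ** B\<close>; transposing the factorization gives \<open>V\<close>.\<close>

lemma rank_mult_eq_right_imp_factor:
  fixes A :: "'a::field^'n^'m" and B :: "'a^'k^'n"
  assumes "rank (A ** B) = rank B"
  obtains V where "B = V ** A ** B"
proof -
  have "range ((*v) (transpose (A ** B))) = range ((*v) (transpose B))"
  proof (rule vec.subspace_dim_equal)
    show "range ((*v) (transpose (A ** B))) \<subseteq> range ((*v) (transpose B))"
      by (auto simp: matrix_transpose_mul simp del: transpose_matrix_vector
          simp flip: matrix_vector_mul_assoc)
    show "vec.dim (range ((*v) (transpose B))) \<le> vec.dim (range ((*v) (transpose (A ** B))))"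
      using assms by (simp add: rank_eq_dim_range_transpose)
  qed (rule subspace_range_matrix)+
  then obtain Z where "transpose B = transpose (A ** B) ** Z"
    by (metis range_subset_imp_factor order_refl)
  then have "B = transpose Z ** A ** B"
    by (metis matrix_mul_assoc matrix_transpose_mul transpose_transpose)
  then show thesis
    by (rule that)
qed

text \<open>The hypothesis makes \<open>M\<close> injective on its own range. By dimension it maps
  this range onto itself, so \<open>M\<close> and \<open>M ** M\<close> have the same range.\<close>

lemma square_factor_right_if_kernel:
  fixes M :: "'a::field^'n^'n"
  assumes "\<And>x. M *v (M *v x) = 0 \<Longrightarrow> M *v x = 0"
  obtains W where "M = M ** M ** W"
proof -
  have sub: "vec.subspace (range ((*v) M))"
    by (rule subspace_range_matrix)
  have "inj_on ((*v) M) (range ((*v) M))"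
  proof (rule inj_onI)
    fix x y assume "x \<in> range ((*v) M)" "y \<in> range ((*v) M)" and eq: "M *v x = M *v y"
    then obtain a b where "x = M *v a" "y = M *v b" by blast
    then show "x = y"
      using assms[of "a - b"] eq by (simp add: matrix_vector_mult_diff_distrib)
  qed
  then have "vec.dim ((*v) M ` range ((*v) M)) = vec.dim (range ((*v) M))"
    using sub by (intro vec.dim_image_eq) (simp_all add: vec.span_eq_iff[THEN iffD2])
  then have "(*v) M ` range ((*v) M) = range ((*v) M)"
    using sub by (intro vec.subspace_dim_equal vec.subspace_image) auto
  then have "range ((*v) M) \<subseteq> range ((*v) (M ** M))"
    by (simp add: image_image matrix_vector_mul_assoc)
  then show thesis
    using range_subset_imp_factor that by metis
qed

section \<open>The index of a matrix\<close>

lemma matpow_2: "matpow A 2 = A ** A"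
  by (simp add: matpow_def numeral_2_eq_2)

text \<open>The \<open>LEAST\<close> in the index is attained: otherwise every further power would
  lower the rank by at least one, which cannot happen more often than the initial rank.\<close>

lemma matrix_index_rank: "rank (matpow A (matrix_index A)) = rank (matpow A (matrix_index A + 1))"
  unfolding matrix_index_def
proof (rule LeastI_ex)
  show "\<exists>k. rank (matpow A k) = rank (matpow A (k + 1))"
  proof (rule ccontr)
    assume "\<not> ?thesis"
    moreover have "rank (matpow A (k + 1)) \<le> rank (matpow A k)" for k
      by (simp add: matpow_def rank_mult_le_right)
    ultimately have less: "rank (matpow A (Suc k)) < rank (matpow A k)" for k
      by (metis Suc_eq_plus1 le_neq_implies_less)
    have "rank (matpow A k) + k \<le> rank (matpow A 0)" for k
    proof (induction k)
      case (Suc k)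
      then show ?case using less[of k] by linarith
    qed simp
    from this[of "Suc (rank (matpow A 0))"] show False by simp
  qed
qed

text \<open>The equality of ranks yields \<open>V\<close> through row spaces. With \<open>V\<close>,
  \<open>A *v (A *v x) = 0\<close> forces \<open>A *v x = 0\<close>, and this kernel condition
  yields \<open>W\<close>.\<close>

lemma matrix_index_1_imp_factors:
  fixes A :: "complex^'n^'n"
  assumes "matrix_index A = 1"
  obtains V W where "A = V ** A ** A" "A = A ** A ** W"
proof -
  have "rank (A ** A) = rank A"
    using matrix_index_rank[of A] assms by (simp add: matpow_def)
  then obtain V where V: "A = V ** A ** A"
    by (rule rank_mult_eq_right_imp_factor)
  obtain W where "A = A ** A ** W"
  proof (rule square_factor_right_if_kernel)
    show "A *v x = 0" if "A *v (A *v x) = 0" for x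
      using that V by (metis matrix_vector_mul_assoc matrix_vector_mult_0_right)
  qed
  with V show thesis
    by (rule that)
qed

section \<open>Group inverses\<close>

definition is_group_inverse :: "'a::semiring_1^'n^'n \<Rightarrow> 'a^'n^'n \<Rightarrow> bool" where
  "is_group_inverse H K \<longleftrightarrow> H ** K ** H = H \<and> K ** H ** K = K \<and> H ** K = K ** H"

text \<open>Evaluating \<open>V ** M ** M ** W\<close> in two ways gives
  \<open>V ** M = M ** W\<close>. Both products of \<open>M\<close> with the candidate equal this
  common matrix.\<close>

lemma group_inverse_if_factors:
  fixes M :: "'a::comm_semiring_1^'n^'n"
  assumes V: "M = V ** M ** M" and W: "M = M ** M ** W"
  shows "is_group_inverse M (V ** M ** W)"
proof -
  have "V ** M = V ** M ** M ** W"
    using arg_cong[OF W, of "(**) V"] by (simp add: matrix_mul_assoc)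
  then have VM: "V ** M = M ** W"
    by (simp flip: V)
  define K where "K = V ** M ** W"
  have MK: "M ** K = M ** W"
    unfolding K_def VM by (simp add: matrix_mul_assoc flip: W)
  have "K = V ** (V ** M)"
    by (simp only: K_def VM[symmetric] matrix_mul_assoc[symmetric])
  then have "K ** M = V ** (V ** M ** M)"
    by (simp add: matrix_mul_assoc)
  then have KM: "K ** M = V ** M"
    by (simp flip: V)
  have "M ** K ** M = M"
    by (simp add: MK flip: VM V)
  moreover have "K ** M ** K = V ** (M ** K)"
    by (simp add: KM matrix_mul_assoc)
  then have "K ** M ** K = K"
    unfolding MK by (simp add: K_def matrix_mul_assoc)
  ultimately have "is_group_inverse M K"
    by (simp add: is_group_inverse_def MK KM VM)
  then show ?thesis
    by (simp add: K_def)
qed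

text \<open>For Hermitian \<open>H\<close>, the square is \<open>cadjoint H ** H\<close>, which has
  the same kernel as \<open>H\<close>; hence a right factor \<open>W\<close> exists. Its conjugate
  transpose serves as the left factor.\<close>

lemma hermitian_group_inverse_exists:
  assumes "cadjoint H = H"
  obtains K where "is_group_inverse H K"
proof -
  obtain W where W: "H = H ** H ** W"
  proof (rule square_factor_right_if_kernel)
    fix x assume 0: "H *v (H *v x) = 0"
    \<comment> \<open>All columns of the square matrix \<open>X\<close> equal \<open>x\<close>, so
      the cancellation lemma for matrices applies to a vector.\<close>
    define X where "X = (\<chi> i (j::'a). x $ i)"
    have col: "(M ** X) $ i $ j = (M *v x) $ i" for M :: "complex^'a^'a" and i j
      by (simp add: X_def matrix_matrix_mult_def matrix_vector_mult_def)
    have "cadjoint H ** H ** X = 0"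
      unfolding assms using 0 col[of "H ** H"] by (simp add: vec_eq_iff matrix_vector_mul_assoc)
    then have "H ** X = 0"
      by (rule cadjoint_mult_cancel)
    then show "H *v x = 0"
      using col[of H] by (simp add: vec_eq_iff)
  qed
  have "cadjoint (H ** H ** W) = cadjoint W ** H ** H"
    by (simp add: assms cadjoint_mult matrix_mul_assoc)
  then have "H = cadjoint W ** H ** H"
    by (simp add: assms flip: W)
  from group_inverse_if_factors[OF this W] show thesis
    by (rule that)
qed

section \<open>Limits of inverses and resolvents\<close>

lemma bounded_bilinear_matrix_mult:
  "bounded_bilinear ((**) :: complex^'n^'m \<Rightarrow> complex^'k^'n \<Rightarrow> complex^'k^'m)"
proof -
  have "bilinear ((**) :: complex^'n^'m \<Rightarrow> complex^'k^'n \<Rightarrow> complex^'k^'m)"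
    unfolding bilinear_def
    by (intro conjI allI linearI)
       (simp_all only: matrix_add_ldistrib matrix_add_rdistrib matrix_scalar_ac scalar_matrix_assoc)
  then show ?thesis
    by (rule bilinear_conv_bounded_bilinear[THEN iffD1])
qed

lemmas tendsto_matrix_mult = bounded_bilinear.tendsto[OF bounded_bilinear_matrix_mult]

text \<open>Once \<open>norm (E x) * C < 1 / 2\<close>, multiplication by \<open>E x\<close> at
  least halves norms, so \<open>mat 1 + E x\<close> has trivial kernel. Its inverse \<open>R\<close>
  satisfies \<open>R = mat 1 - E x ** R\<close>, hence \<open>norm R\<close> is at most twice
  \<open>norm (mat 1)\<close>, and \<open>E x ** R\<close> tends to 0.\<close>

lemma inverse_near_mat_1:
  fixes E :: "'x \<Rightarrow> complex^'n^'n"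
  assumes "(E \<longlongrightarrow> 0) F"
  shows "\<forall>\<^sub>F x in F. invertible (mat 1 + E x)"
    and "((\<lambda>x. matrix_inv (mat 1 + E x)) \<longlongrightarrow> mat 1) F"
proof -
  obtain C where C: "C > 0" and le: "norm (M ** N) \<le> norm M * norm N * C" for M N :: "complex^'n^'n"
    using bounded_bilinear.pos_bounded[OF bounded_bilinear_matrix_mult] by blast
  have "((\<lambda>x. norm (E x) * C) \<longlongrightarrow> 0) F"
    by (intro tendsto_mult_left_zero tendsto_norm_zero assms)
  then have small: "\<forall>\<^sub>F x in F. norm (E x) * C < 1 / 2"
    by (rule order_tendstoD(2)) simp
  have half: "norm (E x ** M) \<le> norm M / 2" if "norm (E x) * C < 1 / 2" for x and M :: "complex^'n^'n"
  proof -
    have "norm (E x ** M) \<le> norm M * (norm (E x) * C)"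
      using le[of "E x" M] by (simp add: mult_ac)
    also have "\<dots> \<le> norm M * (1 / 2)"
      using that by (intro mult_left_mono) auto
    finally show ?thesis by simp
  qed
  have inv: "invertible (mat 1 + E x)" if "norm (E x) * C < 1 / 2" for x
    unfolding invertible_left_inverse matrix_left_invertible_ker
  proof (intro allI impI)
    fix v assume "(mat 1 + E x) *v v = 0"
    then have "v + E x *v v = 0"
      by (simp add: matrix_vector_mult_add_rdistrib)
    then have v: "E x *v v = - v"
      by (rule minus_unique[symmetric])
    \<comment> \<open>Repeating the kernel vector in every column gives
      \<open>E x ** X = - X\<close>; as \<open>norm X\<close> is then at most its own half,
      \<open>X\<close> vanishes.\<close>
    define X where "X = (\<chi> i (j::'n). v $ i)"
    have "E x ** X = - X"
      using v by (simp add: X_def vec_eq_iff matrix_matrix_mult_def matrix_vector_mult_def)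
    then have "norm X \<le> norm X / 2"
      using half[OF that, of X] by (simp only: norm_minus_cancel)
    then have "X = 0"
      by simp
    then show "v = 0"
      by (simp add: X_def vec_eq_iff)
  qed
  then show "\<forall>\<^sub>F x in F. invertible (mat 1 + E x)"
    using small by (rule eventually_mono[rotated])
  have "norm (matrix_inv (mat 1 + E x) - mat 1) \<le> norm (E x) * (2 * norm (mat 1 :: complex^'n^'n) * C)"
    if x: "norm (E x) * C < 1 / 2" for x
  proof -
    define R where "R = matrix_inv (mat 1 + E x)"
    have "(mat 1 + E x) ** R = mat 1"
      unfolding R_def using inv[OF x] by (simp add: matrix_inv)
    then have sum: "R + E x ** R = mat 1"
      by (simp add: matrix_add_rdistrib)
    have "norm R = norm (mat 1 - E x ** R)"
      by (simp flip: sum)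
    also have "\<dots> \<le> norm (mat 1 :: complex^'n^'n) + norm (E x ** R)"
      by (rule norm_triangle_ineq4)
    finally have le_R: "norm R \<le> 2 * norm (mat 1 :: complex^'n^'n)"
      using half[OF x, of R] by linarith
    have "norm (R - mat 1) = norm (E x ** R)"
      by (simp flip: sum)
    then have "norm (R - mat 1) \<le> norm (E x) * norm R * C"
      using le[of "E x" R] by simp
    also have "\<dots> \<le> norm (E x) * (2 * norm (mat 1 :: complex^'n^'n)) * C"
      using C le_R by (intro mult_right_mono mult_left_mono) auto
    finally have "norm (R - mat 1) \<le> norm (E x) * (2 * norm (mat 1 :: complex^'n^'n)) * C" .
    then show ?thesis
      by (simp add: R_def mult_ac)
  qed
  with small have "\<forall>\<^sub>F x in F. norm (matrix_inv (mat 1 + E x) - mat 1) \<le>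
      norm (E x) * (2 * norm (mat 1 :: complex^'n^'n) * C)"
    by (rule eventually_mono)
  moreover have "((\<lambda>x. norm (E x) * (2 * norm (mat 1 :: complex^'n^'n) * C)) \<longlongrightarrow> 0) F"
    using tendsto_mult_right[OF tendsto_norm_zero[OF assms]] by simp
  ultimately have "((\<lambda>x. matrix_inv (mat 1 + E x) - mat 1) \<longlongrightarrow> 0) F"
    by (rule Lim_null_comparison)
  then show "((\<lambda>x. matrix_inv (mat 1 + E x)) \<longlongrightarrow> mat 1) F"
    by (rule Lim_null[THEN iffD2])
qed

text \<open>The condition on \<open>C\<close> says that \<open>C\<close> annihilates
  \<open>mat 1 - H ** K\<close>, which carries the pole of the resolvent at 0. Only the part that
  converges to \<open>K\<close> survives.\<close>

lemma resolvent_limit: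
  fixes H K :: "complex^'n^'n"
  assumes "is_group_inverse H K" and C: "C ** H ** K = C"
  shows "\<forall>\<^sub>F \<mu> in at 0. invertible (H + mat \<mu>)"
    and "((\<lambda>\<mu>. C ** matrix_inv (H + mat \<mu>)) \<longlongrightarrow> C ** K) (at 0)"
proof -
  have HKH: "H ** K ** H = H" and KHK: "K ** H ** K = K" and comm: "H ** K = K ** H"
    using assms by (auto simp: is_group_inverse_def)
  define R where "R \<mu> = matrix_inv (mat 1 + mat \<mu> ** K)" for \<mu>
  \<comment> \<open>\<open>S \<mu>\<close> inverts \<open>H + \<mu>\<close> separately on the range and on the kernel of \<open>H\<close>.\<close>
  define S where "S \<mu> = K ** R \<mu> + (mat 1 - H ** K) ** mat (inverse \<mu>)" for \<mu>
  have "((\<lambda>\<mu>. mat \<mu> :: complex^'n^'n) \<longlongrightarrow> 0) (at 0)"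
  proof (intro vec_tendstoI)
    show "((\<lambda>\<mu>. (mat \<mu> :: complex^'n^'n) $ i $ j) \<longlongrightarrow> 0 $ i $ j) (at 0)" for i j
      by (cases "i = j") (simp_all add: mat_def tendsto_ident_at)
  qed
  then have E: "((\<lambda>\<mu>. mat \<mu> ** K) \<longlongrightarrow> 0) (at 0)"
    using bounded_bilinear.tendsto_left_zero[OF bounded_bilinear_matrix_mult] by blast
  have "\<forall>\<^sub>F \<mu> in at 0. (H + mat \<mu>) ** S \<mu> = mat 1"
    using inverse_near_mat_1(1)[OF E] eventually_neq_at_within[of 0]
  proof eventually_elim
    case (elim \<mu>)
    have R: "(mat 1 + mat \<mu> ** K) ** R \<mu> = mat 1"
      unfolding R_def using elim(1) by (simp add: matrix_inv)
    \<comment> \<open>Because \<open>H ** K ** K = K\<close>, the factor \<open>H ** K\<close> can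
      be pulled out of \<open>(H + mat \<mu>) ** K\<close>; the remaining factor is the one inverted
      by \<open>R \<mu>\<close>.\<close>
    have "H ** K ** (mat 1 + mat \<mu> ** K) = H ** K + H ** K ** (K ** mat \<mu>)"
      by (simp add: matrix_add_ldistrib mat_mult_commute)
    also have "H ** K ** (K ** mat \<mu>) = mat \<mu> ** K"
      by (simp add: comm KHK mat_mult_commute matrix_mul_assoc)
    finally have "(H + mat \<mu>) ** K = H ** K ** (mat 1 + mat \<mu> ** K)"
      by (simp add: matrix_add_rdistrib)
    then have 1: "(H + mat \<mu>) ** (K ** R \<mu>) = H ** K"
      using R by (simp add: matrix_mul_assoc) (simp flip: matrix_mul_assoc[of "H ** K"])
    \<comment> \<open>\<open>H\<close> annihilates \<open>mat 1 - H ** K\<close>, so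
      \<open>H + mat \<mu>\<close> acts there as the scalar \<mu>.\<close>
    have "(H + mat \<mu>) ** (mat 1 - H ** K) = H - H ** (K ** H) + mat \<mu> ** (mat 1 - H ** K)"
      by (simp add: matrix_add_rdistrib matrix_diff_ldistrib comm)
    also have "\<dots> = (mat 1 - H ** K) ** mat \<mu>"
      by (simp add: HKH matrix_mul_assoc mat_mult_commute)
    finally have "(H + mat \<mu>) ** ((mat 1 - H ** K) ** mat (inverse \<mu>)) = mat 1 - H ** K"
      using elim(2) by (simp add: matrix_mul_assoc)
         (simp add: mat_mult_mat flip: matrix_mul_assoc[of _ "mat \<mu>"])
    with 1 show ?case
      by (simp add: S_def matrix_add_ldistrib)
  qed
  then have ev: "\<forall>\<^sub>F \<mu> in at 0. invertible (H + mat \<mu>) \<and> matrix_inv (H + mat \<mu>) = S \<mu>"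
    by (rule eventually_mono) (metis invertible_right_inverse matrix_inv_unique)
  then show "\<forall>\<^sub>F \<mu> in at 0. invertible (H + mat \<mu>)"
    by (rule eventually_mono) simp
  have "((\<lambda>\<mu>. C ** K ** R \<mu>) \<longlongrightarrow> C ** K ** mat 1) (at 0)"
    unfolding R_def by (intro tendsto_matrix_mult tendsto_const inverse_near_mat_1(2) E)
  moreover have "C ** S \<mu> = C ** K ** R \<mu>" for \<mu>
    using C by (simp add: S_def matrix_add_ldistrib matrix_diff_ldistrib matrix_mul_assoc)
  then have "\<forall>\<^sub>F \<mu> in at 0. C ** K ** R \<mu> = C ** matrix_inv (H + mat \<mu>)"
    using ev by (auto elim: eventually_mono)
  ultimately show "((\<lambda>\<mu>. C ** matrix_inv (H + mat \<mu>)) \<longlongrightarrow> C ** K) (at 0)"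
    using Lim_transform_eventually by fastforce
qed

text \<open>Conjugating \<open>H ** K ** H = H\<close> shows that \<open>P = H ** K\<close>
  satisfies \<open>P = P ** cadjoint P\<close>, whose right side is Hermitian. It also gives
  \<open>H ** cadjoint K ** H = H\<close>; multiplied by \<open>K\<close> on both sides, this
  becomes \<open>K = P ** cadjoint K ** P\<close>, the conjugate transpose of
  \<open>P ** K ** P = K\<close>.\<close>

lemma hermitian_group_inverse:
  assumes "is_group_inverse H K" and herm: "cadjoint H = H"
  shows "cadjoint (H ** K) = H ** K" and "cadjoint K = K"
proof -
  have HKH: "H ** K ** H = H" and KHK: "K ** H ** K = K" and comm: "H ** K = K ** H"
    using assms by (auto simp: is_group_inverse_def)
  define P where "P = H ** K"
  have "H ** cadjoint P = H"
    using arg_cong[OF HKH, of cadjoint] by (simp add: P_def cadjoint_mult herm comm)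
  then have *: "P ** cadjoint P = P"
    by (simp add: P_def comm flip: matrix_mul_assoc)
  have "cadjoint (P ** cadjoint P) = P ** cadjoint P"
    by (simp add: cadjoint_mult)
  then have P: "cadjoint P = P"
    by (simp add: *)
  then show "cadjoint (H ** K) = H ** K"
    by (simp add: P_def)
  have "H ** cadjoint K ** H = H"
    using arg_cong[OF HKH, of cadjoint] by (simp add: herm cadjoint_mult matrix_mul_assoc)
  then have "K = K ** (H ** cadjoint K ** H) ** K"
    by (simp add: KHK)
  also have "\<dots> = P ** cadjoint K ** P"
    unfolding P_def by (simp add: matrix_mul_assoc flip: comm)
  also have "\<dots> = cadjoint (P ** K ** P)"
    by (simp add: cadjoint_mult P matrix_mul_assoc)
  also have "P ** K ** P = K"
  proof -
    have "P ** K = K"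
      unfolding P_def comm by (rule KHK)
    then show ?thesis
      by (simp only: KHK P_def matrix_mul_assoc)
  qed
  finally show "cadjoint K = K" by simp
qed

section \<open>Orthogonal projectors, push-through, and uniqueness of the core inverses\<close>

text \<open>Idempotents with a common range absorb each other: \<open>P ** Q = Q\<close> and
  \<open>Q ** P = P\<close>. For Hermitian ones, conjugating the first equation turns its left side
  into \<open>Q ** P\<close>, so \<open>Q = P\<close>.\<close>

lemma range_projector_eqI:
  assumes P: "is_range_projector M P"
  shows "range_projector M = P"
  unfolding range_projector_def
proof (rule the_equality)
  have absorb: "P ** Q = Q" if "is_range_projector M P" "is_range_projector M Q" for P Q
  proof -
    have "P ** P = P" "matrix_range Q \<subseteq> matrix_range P"
      using that by (auto simp: is_range_projector_def)
    then obtain Z where "Q = P ** Z"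
      unfolding matrix_range_subset_iff by blast
    with \<open>P ** P = P\<close> show ?thesis
      by (simp add: matrix_mul_assoc)
  qed
  fix Q assume Q: "is_range_projector M Q"
  have "P ** Q = Q" "Q ** P = P"
    using P Q absorb by blast+
  then show "Q = P"
    using P Q by (metis cadjoint_mult is_range_projector_def)
qed (rule P)

lemma push_through:
  fixes B :: "complex^'n^'m"
  assumes "invertible (B ** C + mat \<mu>)" "invertible (C ** B + mat \<mu>)"
  shows "matrix_inv (C ** B + mat \<mu>) ** C = C ** matrix_inv (B ** C + mat \<mu>)"
proof -
  have "(C ** B + mat \<mu>) ** C = C ** (B ** C + mat \<mu>)"
    by (simp add: matrix_add_ldistrib matrix_add_rdistrib matrix_mul_assoc mat_mult_commute)
  then have "matrix_inv (C ** B + mat \<mu>) ** (C ** B + mat \<mu>) ** C ** matrix_inv (B ** C + mat \<mu>) =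
      matrix_inv (C ** B + mat \<mu>) ** C ** ((B ** C + mat \<mu>) ** matrix_inv (B ** C + mat \<mu>))"
    by (simp add: matrix_mul_assoc) (simp flip: matrix_mul_assoc[of "matrix_inv _"])
  then show ?thesis
    by (simp add: matrix_inv[OF assms(1)] matrix_inv[OF assms(2)])
qed

text \<open>Two candidates \<open>A ** Z\<close> and \<open>A ** Z'\<close> agree after
  multiplication by \<open>A\<close> from the left, and \<open>V\<close> undoes this
  multiplication.\<close>

lemma core_inverse_eqI:
  assumes V: "A = V ** A ** A" and X: "is_core_inverse A X"
  shows "core_inverse A = X"
  unfolding core_inverse_def
proof (rule the_equality)
  fix Y assume "is_core_inverse A Y"
  then obtain Z Z' where "X = A ** Z" "Y = A ** Z'" "A ** X = A ** Y"
    using X by (auto simp: is_core_inverse_def matrix_range_subset_iff)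
  moreover from this have "V ** A ** A ** Z' = V ** A ** A ** Z"
    by (simp flip: matrix_mul_assoc)
  ultimately show "Y = X"
    by (simp flip: V)
qed (rule X)

text \<open>The range condition on \<open>cadjoint X\<close> puts a factor \<open>A\<close> at the
  right end of \<open>X\<close>. Multiplication by \<open>A\<close> from the right can then be
  undone by \<open>W\<close>.\<close>

lemma dual_core_inverse_eqI:
  assumes W: "A = A ** A ** W" and X: "is_dual_core_inverse A X"
  shows "dual_core_inverse A = X"
  unfolding dual_core_inverse_def
proof (rule the_equality)
  fix Y assume "is_dual_core_inverse A Y"
  then obtain Z Z' where "cadjoint X = cadjoint A ** Z" "cadjoint Y = cadjoint A ** Z'"
    and eq: "X ** A = Y ** A"
    using X by (auto simp: is_dual_core_inverse_def matrix_range_subset_iff)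
  then have "X = cadjoint Z ** A" "Y = cadjoint Z' ** A"
    by (metis cadjoint_cadjoint cadjoint_mult)+
  moreover from this have "cadjoint Z' ** (A ** A ** W) = cadjoint Z ** (A ** A ** W)"
    using eq by (simp add: matrix_mul_assoc)
  ultimately show "Y = X"
    by (simp flip: W)
qed (rule X)

theorem corollary4p4:
  fixes A :: "complex^'n^'n"
  assumes "\<not> nilpotent_matrix A"
    and "matrix_index A = 1"
  shows "(\<forall>\<^sub>F \<mu> in at (0::complex).
            invertible (matpow A 2 ** cadjoint (matpow A 2) + mat \<mu>) \<and>
            invertible (cadjoint (matpow A 2) ** matpow A 2 + mat \<mu>)) \<and>
         ((\<lambda>\<mu>::complex. A ** cadjoint (matpow A 2) **
              matrix_inv (matpow A 2 ** cadjoint (matpow A 2) + mat \<mu>))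
            \<longlongrightarrow> core_inverse A) (at 0) \<and>
         ((\<lambda>\<mu>::complex. A **
              matrix_inv (cadjoint (matpow A 2) ** matpow A 2 + mat \<mu>) ** cadjoint (matpow A 2))
            \<longlongrightarrow> core_inverse A) (at 0) \<and>
         ((\<lambda>\<mu>::complex.
              matrix_inv (cadjoint (matpow A 2) ** matpow A 2 + mat \<mu>) ** cadjoint (matpow A 2) ** A)
            \<longlongrightarrow> dual_core_inverse A) (at 0) \<and>
         ((\<lambda>\<mu>::complex. cadjoint (matpow A 2) **
              matrix_inv (matpow A 2 ** cadjoint (matpow A 2) + mat \<mu>) ** A)
            \<longlongrightarrow> dual_core_inverse A) (at 0)"
proof -
  obtain V W where V: "A = V ** A ** A" and W: "A = A ** A ** W"
    using assms(2) by (rule matrix_index_1_imp_factors)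
  define B where "B = matpow A 2"
  define D where "D = cadjoint B"
  define H where "H = B ** D"
  have B: "B = A ** A"
    by (simp add: B_def matpow_2)
  have hermH: "cadjoint H = H" and hermH': "cadjoint (D ** B) = D ** B"
    by (simp_all add: H_def D_def cadjoint_mult)
  obtain K where K: "is_group_inverse H K"
    using hermH by (rule hermitian_group_inverse_exists)
  obtain K' where K': "is_group_inverse (D ** B) K'"
    using hermH' by (rule hermitian_group_inverse_exists)
  have HKH: "H ** K ** H = H" and KHK: "K ** H ** K = K"
    using K by (auto simp: is_group_inverse_def)
  have hermP: "cadjoint (H ** K) = H ** K" and hermK: "cadjoint K = K"
    using hermitian_group_inverse[OF K hermH] by auto
  \<comment> \<open>Here \<open>cadjoint D ** D\<close> is \<open>H\<close>, which annihilates
    \<open>mat 1 - H ** K\<close>. Cancelling \<open>cadjoint D\<close> gives the condition of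
    \<open>resolvent_limit\<close> for \<open>C = D\<close>.\<close>
  have "cadjoint D ** D ** (mat 1 - H ** K) = 0"
  proof -
    have "cadjoint D ** D = H"
      by (simp add: D_def H_def)
    moreover have "H ** (H ** K) = H"
      using HKH K by (metis is_group_inverse_def matrix_mul_assoc)
    ultimately show ?thesis
      by (simp add: matrix_diff_ldistrib)
  qed
  then have "D ** (mat 1 - H ** K) = 0"
    by (rule cadjoint_mult_cancel)
  then have DP: "D ** H ** K = D"
    by (simp add: matrix_diff_ldistrib matrix_mul_assoc)
  have PB: "H ** K ** B = B"
  proof -
    have "H ** K ** B = cadjoint (D ** (H ** K))"
      unfolding cadjoint_mult[of D] hermP by (simp add: D_def)
    also have "\<dots> = B"
      unfolding matrix_mul_assoc DP by (simp add: D_def)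
    finally show ?thesis .
  qed

  have "is_core_inverse A (A ** (D ** K))"
    unfolding is_core_inverse_def
  proof
    \<comment> \<open>The product of \<open>A\<close> with the candidate is
      \<open>B ** D ** K = H ** K\<close>. Its range is that of \<open>A\<close>, since
      \<open>A = B ** W\<close> and \<open>H ** K\<close> fixes \<open>B\<close>.\<close>
    have "is_range_projector A (H ** K)"
      unfolding is_range_projector_def set_eq_subset matrix_range_subset_iff
    proof (intro conjI hermP)
      show "H ** K ** (H ** K) = H ** K"
        by (simp add: HKH matrix_mul_assoc)
      show "\<exists>Z. H ** K = A ** Z"
        by (metis B H_def matrix_mul_assoc)
      show "\<exists>Z. A = H ** K ** Z"
        using PB W by (metis B matrix_mul_assoc)
    qed
    then show "A ** (A ** (D ** K)) = range_projector A"
      by (simp add: range_projector_eqI H_def B matrix_mul_assoc)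
    show "matrix_range (A ** (D ** K)) \<subseteq> matrix_range A"
      unfolding matrix_range_subset_iff by blast
  qed
  then have core: "core_inverse A = A ** (D ** K)"
    by (rule core_inverse_eqI[OF V])

  have D: "D = cadjoint A ** cadjoint A"
    by (simp add: D_def B cadjoint_mult)
  have "is_dual_core_inverse A (D ** K ** A)"
    unfolding is_dual_core_inverse_def
  proof (intro conjI)
    \<comment> \<open>Likewise the candidate times \<open>A\<close> is \<open>D ** K ** B\<close>.
      It fixes \<open>D\<close>, and \<open>cadjoint A = D ** cadjoint V\<close> places the range of
      \<open>cadjoint A\<close> inside its range.\<close>
    have "is_range_projector (cadjoint A) (D ** K ** B)"
      unfolding is_range_projector_def set_eq_subset matrix_range_subset_iff
    proof (intro conjI)
      show "D ** K ** B ** (D ** K ** B) = D ** K ** B"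
      proof -
        have "D ** K ** B ** (D ** K ** B) = D ** (K ** H ** K) ** B"
          by (simp add: H_def matrix_mul_assoc)
        then show ?thesis
          by (simp add: KHK)
      qed
      show "cadjoint (D ** K ** B) = D ** K ** B"
        by (simp add: D_def cadjoint_mult hermK matrix_mul_assoc)
      show "\<exists>Z. D ** K ** B = cadjoint A ** Z"
        by (metis D matrix_mul_assoc)
      have "D ** K ** B ** D = D"
      proof -
        have "D ** K ** B ** D = D ** (K ** H)"
          by (simp add: H_def matrix_mul_assoc)
        also have "K ** H = H ** K"
          using K by (simp add: is_group_inverse_def)
        finally show ?thesis
          using DP by (simp add: matrix_mul_assoc)
      qed
      moreover have "cadjoint A = D ** cadjoint V"
        using arg_cong[OF V, of cadjoint] by (simp add: D cadjoint_mult matrix_mul_assoc)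
      ultimately show "\<exists>Z. cadjoint A = D ** K ** B ** Z"
        by (metis matrix_mul_assoc)
    qed
    then show "D ** K ** A ** A = range_projector (cadjoint A)"
      by (simp add: range_projector_eqI B matrix_mul_assoc)
    show "matrix_range (D ** K ** A) \<subseteq> matrix_range (cadjoint A)"
      unfolding matrix_range_subset_iff by (metis D matrix_mul_assoc)
    show "matrix_range (cadjoint (D ** K ** A)) \<subseteq> matrix_range (cadjoint A)"
      unfolding matrix_range_subset_iff by (metis cadjoint_mult)
  qed
  then have dual: "dual_core_inverse A = D ** K ** A"
    by (rule dual_core_inverse_eqI[OF W])

  \<comment> \<open>Invertibility near 0 is obtained with \<open>C = 0\<close>, which satisfies the
    condition on \<open>C\<close> trivially. \<open>K'\<close> enters only here; the limit for
    \<open>D ** B\<close> comes from push-through.\<close>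
  have inv: "\<forall>\<^sub>F \<mu> in at 0. invertible (B ** D + mat \<mu>) \<and> invertible (D ** B + mat \<mu>)"
    using resolvent_limit(1)[OF K, of 0] resolvent_limit(1)[OF K', of 0]
    by (simp add: H_def eventually_conj_iff)
  have lim: "((\<lambda>\<mu>. D ** matrix_inv (B ** D + mat \<mu>)) \<longlongrightarrow> D ** K) (at 0)"
    using resolvent_limit(2)[OF K DP] by (simp add: H_def)
  moreover have "\<forall>\<^sub>F \<mu> in at 0. D ** matrix_inv (B ** D + mat \<mu>) = matrix_inv (D ** B + mat \<mu>) ** D"
    using inv by (rule eventually_mono) (simp add: push_through)
  ultimately have lim': "((\<lambda>\<mu>. matrix_inv (D ** B + mat \<mu>) ** D) \<longlongrightarrow> D ** K) (at 0)"
    by (rule Lim_transform_eventually)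
  \<comment> \<open>Reassociating the products that begin with \<open>A\<close> isolates
    \<open>A\<close> as a constant outer factor of the two known limits.\<close>
  show ?thesis
    unfolding core dual B_def[symmetric] D_def[symmetric] matrix_mul_assoc[symmetric, of A]
    by (intro conjI inv tendsto_matrix_mult tendsto_const lim lim')
qed

end
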